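(* A matroid $M$ is claw-free and anticlaw-free if and only if $M$ is a target.
   Context: A matroid is a pair $M=(E,G)$ where $G$ is the set of nonzero vectors of a finite-dimensional $\mathbb F_2$-vector space $V(G)=G\cup\{0\}$ and $E\subseteq G$. Isomorphism: a linear isomorphism of ambient spaces mapping ground sets onto each other. A flat of $G$ is a set $F\subseteq G$ with $F\cup\{0\}$ a subspace (the empty set is a flat). $M|F=(E\cap F,F)$; $M$ is $N$-free if no induced restriction $M|F$ is isomorphic to $N$. A claw is $(B,G)$ with $\dim G=3$ and $B$ a basis of $V(G)$; an anticlaw is the complement $(G\setminus B,G)$ of a claw. $M$ is a target if there exist flats $F_0\subseteq F_1\subseteq\cdots\subseteq F_k\subseteq G$ (possibly empty) such that $E$ is the union of the sets $F_{i+1}\setminus F_i$ over all even $i<k$. *)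

theory Defs
  imports "HOL-Library.Z2" "HOL-Analysis.Cartesian_Space"
begin

text \<open>
  The two-element field is the type \<open>bit\<close>. An ambient space need not be a whole type: it is a
  finite-dimensional subspace of a \<open>bit\<close>-vector space with scalar multiplication \<open>s\<close>. A matroid
  is a pair \<open>(E, G)\<close>, where \<open>G\<close> is the set of nonzero vectors of the ambient space.
\<close>

type_synonym 'a matroid = "'a set \<times> 'a set"

type_synonym 'a scaling = "bit \<Rightarrow> 'a \<Rightarrow> 'a"

definition V :: "'a::zero set \<Rightarrow> 'a set" where
  "V G = G \<union> {0}"

definition is_matroid :: "'a::ab_group_add scaling \<Rightarrow> 'a matroid \<Rightarrow> bool" where
  "is_matroid s = (\<lambda>(E, G). 0 \<notin> G \<and> module.subspace s (V G) \<and>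
     (\<exists>S. finite S \<and> module.span s S = V G) \<and> E \<subseteq> G)"

definition flat :: "'a::ab_group_add scaling \<Rightarrow> 'a set \<Rightarrow> 'a set \<Rightarrow> bool" where
  "flat s G F \<longleftrightarrow> F \<subseteq> G \<and> module.subspace s (V F)"

definition induced_restriction :: "'a matroid \<Rightarrow> 'a set \<Rightarrow> 'a matroid" where
  "induced_restriction M F = (fst M \<inter> F, F)"

definition matroid_complement :: "'a matroid \<Rightarrow> 'a matroid" where
  "matroid_complement = (\<lambda>(E, G). (G - E, G))"

definition isomorphic ::
    "'a::ab_group_add scaling \<Rightarrow> 'b::ab_group_add scaling \<Rightarrow> 'a matroid \<Rightarrow> 'b matroid \<Rightarrow> bool" where
  "isomorphic s t = (\<lambda>(E, G) (E', G'). \<exists>f. bij_betw f (V G) (V G') \<and>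
     (\<forall>x\<in>V G. \<forall>y\<in>V G. f (x + y) = f x + f y) \<and>
     (\<forall>c. \<forall>x\<in>V G. f (s c x) = t c (f x)) \<and>
     f ` E = E')"

definition matroid_free ::
    "'a::ab_group_add scaling \<Rightarrow> 'b::ab_group_add scaling \<Rightarrow> 'b matroid \<Rightarrow> 'a matroid \<Rightarrow> bool" where
  "matroid_free s t N M \<longleftrightarrow>
     \<not> (\<exists>F. flat s (snd M) F \<and> isomorphic s t (induced_restriction M F) N)"

definition is_claw :: "'a::ab_group_add scaling \<Rightarrow> 'a matroid \<Rightarrow> bool" where
  "is_claw s = (\<lambda>(B, G). is_matroid s (B, G) \<and> vector_space.dim s (V G) = 3 \<and>
     module.independent s B \<and> module.span s B = V G)"

definition is_anticlaw :: "'a::ab_group_add scaling \<Rightarrow> 'a matroid \<Rightarrow> bool" where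
  "is_anticlaw s N \<longleftrightarrow> (\<exists>C. is_claw s C \<and> N = matroid_complement C)"

text \<open>
  Being free of a matroid depends only on its isomorphism class, and every claw or anticlaw, over
  whatever type, is isomorphic to one in the three-dimensional coordinate space \<open>bit ^ 3\<close>. Hence
  the excluded matroids may be taken from that space.
\<close>

definition claw_free :: "'a::ab_group_add scaling \<Rightarrow> 'a matroid \<Rightarrow> bool" where
  "claw_free s M \<longleftrightarrow> (\<forall>N :: (bit ^ 3) matroid.
       is_claw vector_scalar_mult N \<longrightarrow> matroid_free s vector_scalar_mult N M)"

definition anticlaw_free :: "'a::ab_group_add scaling \<Rightarrow> 'a matroid \<Rightarrow> bool" where
  "anticlaw_free s M \<longleftrightarrow>
     (\<forall>N :: (bit ^ 3) matroid.
       is_anticlaw vector_scalar_mult N \<longrightarrow> matroid_free s vector_scalar_mult N M)"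

definition target :: "'a::ab_group_add scaling \<Rightarrow> 'a matroid \<Rightarrow> bool" where
  "target s = (\<lambda>(E, G). \<exists>(k::nat) F. (\<forall>i\<le>k. flat s G (F i)) \<and> (\<forall>i<k. F i \<subseteq> F (i + 1)) \<and>
     E = (\<Union>i\<in>{i. i < k \<and> even i}. F (i + 1) - F i))"

end

theory Submission
  imports Defs
begin

text \<open>
  Colour the vectors by membership in \<open>E\<close>. A target is a colouring built up along a chain of
  subspaces, each new layer being monochromatic, so everything rests on one claim: if neither colour
  class contains a claw, then some hyperplane has a monochromatic complement. By induction
  on the ambient space \<open>W\<close>, a hyperplane \<open>H\<close> has a hyperplane \<open>K\<close> with \<open>H - K\<close> monochromatic. If the
  claim fails for \<open>W\<close>, at least one of the other two hyperplanes through \<open>K\<close> has both colours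
  outside \<open>K\<close>. Applying the induction hypothesis to it, and to the other one if that also has both
  colours outside \<open>K\<close>, yields a three-dimensional subspace in which one colour class is a basis,
  or traps one colour in a proper subspace.
\<close>

text \<open>
  Linear independence of \<open>a\<close>, \<open>b\<close>, \<open>c\<close> need not be required here: over the two-element field any
  linear dependence would identify two vectors of opposite colours. For the same reason the
  value of \<open>P\<close> at \<open>0\<close> is irrelevant.
\<close>

definition noclaw :: "'a::ab_group_add set \<Rightarrow> ('a \<Rightarrow> bool) \<Rightarrow> bool" where
  "noclaw W P \<longleftrightarrow> (\<forall>a\<in>W. \<forall>b\<in>W. \<forall>c\<in>W. \<not> (P a \<and> P b \<and> P c \<and>
     \<not> P (a + b) \<and> \<not> P (a + c) \<and> \<not> P (b + c) \<and> \<not> P (a + b + c)))"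

lemma noclawD:
  assumes "noclaw W P" "a \<in> W" "b \<in> W" "c \<in> W" "P a" "P b" "P c"
    "\<not> P (a + b)" "\<not> P (a + c)" "\<not> P (b + c)"
  shows "P (a + b + c)"
  using assms unfolding noclaw_def by blast

lemma noclaw_subset: "noclaw W P \<Longrightarrow> U \<subseteq> W \<Longrightarrow> noclaw U P"
  unfolding noclaw_def by blast

definition constant_outside :: "('a \<Rightarrow> bool) \<Rightarrow> 'a set \<Rightarrow> 'a set \<Rightarrow> bool" where
  "constant_outside P W D \<longleftrightarrow> (\<forall>x\<in>W - D. \<forall>y\<in>W - D. P x = P y)"

lemma constant_outside_Not: "constant_outside (\<lambda>x. \<not> P x) W D = constant_outside P W D"
  unfolding constant_outside_def by blast

section \<open>Hyperplanes over the two-element field\<close>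

locale binary_space = vector_space s for s :: "bit \<Rightarrow> 'a::ab_group_add \<Rightarrow> 'a"
begin

lemma add_self: "x + x = (0::'a)"
proof -
  have "s (1 + 1) x = s 1 x + s 1 x" by (rule scale_left_distrib)
  then show ?thesis by simp
qed

lemma add_self_left: "x + (x + y) = (y::'a)"
  by (simp add: add.assoc [symmetric] add_self)

lemmas char2_simps = add.assoc add.commute add.left_commute add_self add_self_left

lemma subspace_iff: "subspace W \<longleftrightarrow> 0 \<in> W \<and> (\<forall>x\<in>W. \<forall>y\<in>W. x + y \<in> W)"
proof -
  have "s c x \<in> W" if "0 \<in> W" "x \<in> W" for c x
    using that by (cases c) auto
  then show ?thesis unfolding subspace_def by blast
qed

lemma add_mem_iff: "subspace W \<Longrightarrow> x \<in> W \<Longrightarrow> x + y \<in> W \<longleftrightarrow> y \<in> W"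
  by (metis add_self_left subspace_iff)

lemma add_mem_iff': "subspace W \<Longrightarrow> x \<in> W \<Longrightarrow> y + x \<in> W \<longleftrightarrow> y \<in> W"
  by (metis add_mem_iff add.commute)

text \<open>Codimension one without dimensions: for a subspace \<open>W\<close>, the last conjunct
  makes \<open>W - H\<close> a single coset of \<open>H\<close>.\<close>

definition hyperplane :: "'a set \<Rightarrow> 'a set \<Rightarrow> bool" where
  "hyperplane W H \<longleftrightarrow> subspace H \<and> H \<subset> W \<and> (\<forall>x\<in>W - H. \<forall>y\<in>W - H. x + y \<in> H)"

lemma hyperplaneD:
  assumes "hyperplane W H"
  shows "subspace H" "H \<subset> W" "x \<in> W \<Longrightarrow> x \<notin> H \<Longrightarrow> y \<in> W \<Longrightarrow> y \<notin> H \<Longrightarrow> x + y \<in> H"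
  using assms unfolding hyperplane_def by auto

text \<open>If \<open>A\<close> lay inside \<open>B\<close>, a vector of \<open>B - A\<close> and
  one of \<open>U - B\<close> would both be outside \<open>A\<close>, so their sum would lie in
  \<open>A\<close> and hence in \<open>B\<close>, forcing the second one into
  \<open>B\<close>.\<close>

lemma hyperplane_not_nested:
  assumes "hyperplane U A" "hyperplane U B" "A \<noteq> B" "subspace U"
  shows "\<exists>k. k \<in> A \<and> k \<notin> B"
proof (rule ccontr)
  assume "\<not> ?thesis"
  then have "A \<subseteq> B" by blast
  then obtain y where y: "y \<in> B" "y \<notin> A" using assms(3) by blast
  obtain z where z: "z \<in> U" "z \<notin> B" using hyperplaneD(2) [OF assms(2)] by blast
  have "y \<in> U" using y hyperplaneD(2) [OF assms(2)] by blast
  then have "y + z \<in> A" using hyperplaneD(3) [OF assms(1)] y z \<open>A \<subseteq> B\<close> by blast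
  then have "y + z \<in> B" using \<open>A \<subseteq> B\<close> by blast
  then show False using add_mem_iff hyperplaneD(1) [OF assms(2)] y z by blast
qed

text \<open>For a subspace \<open>K\<close> this is the span of \<open>K\<close> and
  \<open>x\<close>: over the two-element field, \<open>x + y \<in> K\<close> puts \<open>y\<close>
  in the coset of \<open>x\<close>.\<close>

definition adjoin :: "'a \<Rightarrow> 'a set \<Rightarrow> 'a set" where
  "adjoin x K = {y. y \<in> K \<or> x + y \<in> K}"

lemma subspace_adjoin:
  assumes "subspace K"
  shows "subspace (adjoin x K)"
proof -
  have 1: "0 \<in> K" "\<And>u v. u \<in> K \<Longrightarrow> v \<in> K \<Longrightarrow> u + v \<in> K"
    using assms by (auto simp: subspace_iff)
  have "u + v \<in> adjoin x K" if "u \<in> adjoin x K" "v \<in> adjoin x K" for u v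
  proof -
    have "u + v = (x + u) + (x + v)" "x + (u + v) = (x + u) + v" "x + (u + v) = u + (x + v)"
      by (simp_all add: char2_simps)
    then show ?thesis using that 1(2) unfolding adjoin_def by (metis (mono_tags, lifting) mem_Collect_eq)
  qed
  then show ?thesis using 1 by (auto simp: subspace_iff adjoin_def)
qed

lemma subset_adjoin: "K \<subseteq> adjoin x K"
  by (auto simp: adjoin_def)

lemma mem_adjoin_self: "subspace K \<Longrightarrow> x \<in> adjoin x K"
  by (auto simp: adjoin_def add_self subspace_iff)

lemma adjoin_subset:
  assumes "subspace W" "K \<subseteq> W" "x \<in> W"
  shows "adjoin x K \<subseteq> W"
  using assms add_mem_iff unfolding adjoin_def by blast

lemma hyperplane_adjoin:
  assumes "subspace K" "x \<notin> K"
  shows "hyperplane (adjoin x K) K"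
proof -
  have "u + v \<in> K" if "x + u \<in> K" "x + v \<in> K" for u v
  proof -
    have "u + v = (x + u) + (x + v)" by (simp add: char2_simps)
    then show ?thesis using that assms(1) by (metis subspace_iff)
  qed
  then have "u + v \<in> K" if "u \<in> adjoin x K - K" "v \<in> adjoin x K - K" for u v
    using that unfolding adjoin_def by blast
  moreover have "K \<subset> adjoin x K" using assms subset_adjoin mem_adjoin_self by blast
  ultimately show ?thesis using assms unfolding hyperplane_def by blast
qed

text \<open>A maximal proper subspace \<open>H\<close> above \<open>D\<close> works: if
  \<open>x\<close>, \<open>y\<close> and \<open>x + y\<close> were all outside \<open>H\<close>,
  then \<open>adjoin x H\<close> would be larger and still miss \<open>y\<close>.\<close>

lemma proper_subspace_in_hyperplane:
  assumes "finite W" "subspace W" "subspace D" "D \<subset> W"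
  shows "\<exists>H. hyperplane W H \<and> D \<subseteq> H"
proof -
  let ?S = "{U. subspace U \<and> D \<subseteq> U \<and> U \<subset> W}"
  have "finite ?S" by (rule finite_subset [of _ "Pow W"]) (use assms in auto)
  moreover have "?S \<noteq> {}" using assms by blast
  ultimately have "\<exists>H\<in>?S. \<forall>U\<in>?S. H \<subseteq> U \<longrightarrow> H = U" by (rule finite_has_maximal)
  then obtain H where H: "H \<in> ?S" and max: "\<forall>U\<in>?S. H \<subseteq> U \<longrightarrow> H = U" by (rule bexE)
  have "x + y \<in> H" if "x \<in> W" "x \<notin> H" "y \<in> W" "y \<notin> H" for x y
  proof (rule ccontr)
    assume "x + y \<notin> H"
    then have "y \<notin> adjoin x H" using that by (simp add: adjoin_def)
    then have "adjoin x H \<in> ?S"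
      using H subspace_adjoin [of H x] subset_adjoin [of H x] adjoin_subset [of W H x] that assms
      by blast
    then have "H = adjoin x H" using max subset_adjoin [of H x] by blast
    then show False using mem_adjoin_self [of H x] H that by blast
  qed
  then show ?thesis using H unfolding hyperplane_def by blast
qed

text \<open>Constancy survives enlarging \<open>D\<close>, so trapping one colour in any proper
  subspace suffices.\<close>

lemma constant_outside_hyperplane:
  assumes "finite W" "subspace W" "subspace D" "D \<subset> W" "constant_outside P W D"
  shows "\<exists>H. hyperplane W H \<and> constant_outside P W H"
  using proper_subspace_in_hyperplane [OF assms(1-4)] assms(5)
  unfolding constant_outside_def by blast

section \<open>A hyperplane with monochromatic complement\<close>

text \<open>With \<open>h\<close> in \<open>H - K\<close> and \<open>b\<close> outside
  \<open>H\<close>, the cosets of \<open>K\<close> in \<open>W\<close> are \<open>K\<close>,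
  \<open>h + K\<close>, \<open>b + K\<close> and \<open>b + h + K\<close>. Joined to
  \<open>K\<close>, the last three give \<open>H\<close>, \<open>?H1\<close> and \<open>?H2\<close>.
  If the claim fails, both colours occur outside every proper subspace.\<close>

lemma constant_outside_step:
  assumes W: "subspace W" and nc: "noclaw W P" "noclaw W (\<lambda>x. \<not> P x)"
    and H: "hyperplane W H" and K: "hyperplane H K" and PK: "\<And>x. x \<in> H \<Longrightarrow> x \<notin> K \<Longrightarrow> P x"
    and IH: "\<And>U. subspace U \<Longrightarrow> U \<subset> W \<Longrightarrow> U \<noteq> {0} \<Longrightarrow>
      \<exists>L. hyperplane U L \<and> constant_outside P U L"
  shows "\<exists>D. subspace D \<and> D \<subset> W \<and> constant_outside P W D"
proof (rule ccontr)
  assume "\<not> ?thesis"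
  then have ex: "(\<exists>x\<in>W. x \<notin> D \<and> P x) \<and> (\<exists>x\<in>W. x \<notin> D \<and> \<not> P x)"
    if "subspace D" "D \<subset> W" for D
    using that unfolding constant_outside_def by (metis DiffD1 DiffD2)
  note sH = hyperplaneD(1) [OF H] and sK = hyperplaneD(1) [OF K]
  have HW: "H \<subseteq> W" and KH: "K \<subseteq> H" using hyperplaneD(2) H K by blast+
  have addW: "x + y \<in> W" if "x \<in> W" "y \<in> W" for x y using W that by (simp add: subspace_iff)
  obtain b where b: "b \<in> W" "b \<notin> H" "P b" using ex [OF sH] hyperplaneD(2) [OF H] by blast
  obtain h where h: "h \<in> H" "h \<notin> K" using hyperplaneD(2) [OF K] by blast
  have Ph: "P h" using PK h by blast
  have bh: "b + h \<in> W" "b + h \<notin> H" using b h HW addW add_mem_iff' [OF sH] by blast+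
  let ?H1 = "adjoin b K" and ?H2 = "adjoin (b + h) K"
  have bK: "b \<notin> K" and bhK: "b + h \<notin> K" using b bh KH by blast+
  note s1 = subspace_adjoin [OF sK, of b] and s2 = subspace_adjoin [OF sK, of "b + h"]
  note h1 = hyperplane_adjoin [OF sK bK] and h2 = hyperplane_adjoin [OF sK bhK]
  have "b \<notin> ?H2" using bK h by (auto simp: adjoin_def char2_simps)
  then have p2: "?H2 \<subset> W" using adjoin_subset [OF W, of K "b + h"] bh b KH HW by blast
  have "b + h \<notin> ?H1" using bhK h by (auto simp: adjoin_def char2_simps)
  then have p1: "?H1 \<subset> W" using adjoin_subset [OF W, of K b] bh b KH HW by blast
  have cases: "x \<in> K \<or> (x \<in> H \<and> x \<notin> K) \<or> (x \<notin> H \<and> x \<notin> K \<and> b + x \<in> K) \<or> (x \<notin> H \<and> x \<notin> K \<and> b + h + x \<in> K)"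
    if "x \<in> W" for x
  proof (cases "x \<in> H")
    case False
    then have 1: "b + x \<in> H" using hyperplaneD(3) [OF H] b that by blast
    have "h + (b + x) \<in> K" if "b + x \<notin> K" using hyperplaneD(3) [OF K] h that 1 by blast
    then show ?thesis using False KH by (auto simp: add_ac)
  qed auto
  \<comment> \<open>A vector violating \<open>P\<close> outside \<open>?H2\<close> lies in
    \<open>h + K\<close> or \<open>b + K\<close>, and \<open>P\<close> holds on the former. In the
    same way \<open>r2\<close> falls into \<open>b + h + K\<close>.\<close>
  obtain r where r: "r \<in> W" "\<not> P r" "r \<notin> H" "b + r \<in> K"
    using ex [OF s2 p2] cases PK unfolding adjoin_def by blast
  obtain r2 where r2: "r2 \<in> W" "\<not> P r2" "r2 \<notin> H" "b + h + r2 \<in> K"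
    using ex [OF s1 p1] cases PK unfolding adjoin_def by blast
  have zero: "0 \<in> K" using sK by (simp add: subspace_iff)
  have b1: "b \<in> ?H1" "r \<in> ?H1" using mem_adjoin_self [OF sK] r by (auto simp: adjoin_def)
  then have "?H1 \<noteq> {0}" using bK zero by (metis singletonD)
  then obtain K1 where K1: "hyperplane ?H1 K1" and c1: "constant_outside P ?H1 K1"
    using IH [OF s1 p1] by blast
  note sK1 = hyperplaneD(1) [OF K1]
  \<comment> \<open>\<open>b\<close> and \<open>r\<close> have opposite colours and both lie in
    \<open>?H1 - K\<close>.\<close>
  have "K1 \<noteq> K" using c1 b1 b r KH unfolding constant_outside_def by blast
  then obtain k1 where k1: "k1 \<in> K" "k1 \<notin> K1"
    using hyperplane_not_nested [OF h1 K1] s1 by blast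
  have K_H1: "K \<subseteq> ?H1" and K_H2: "K \<subseteq> ?H2" by (rule subset_adjoin)+
  \<comment> \<open>The cosets of \<open>r\<close> and \<open>r2\<close> sum to
    \<open>h + K\<close>, where \<open>P\<close> holds.\<close>
  have rH: "r + r2 \<in> H" "r + r2 \<notin> K"
  proof -
    have e: "r + r2 = h + ((b + r) + (b + h + r2))" by (simp add: char2_simps)
    have "(b + r) + (b + h + r2) \<in> K" using r(4) r2(4) sK by (simp add: subspace_iff)
    then show "r + r2 \<in> H" "r + r2 \<notin> K"
      unfolding e using h KH add_mem_iff' sK sH by (metis subsetD)+
  qed
  have hW: "h \<in> W" and k1W: "k1 \<in> W" using h k1 HW KH by blast+
  \<comment> \<open>The coset \<open>b + h + K\<close> contains \<open>r2\<close>, so it either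
    violates \<open>P\<close> throughout or has both colours; in the latter case the induction
    hypothesis is applied to \<open>?H2\<close> as well.\<close>
  show False
  proof (cases "\<forall>x\<in>W. b + h + x \<in> K \<longrightarrow> \<not> P x")
    case True
    \<comment> \<open>All of \<open>?H1 - K1\<close> has the colour of \<open>k1\<close>, so
      whichever of \<open>r\<close> and \<open>b\<close> has the other colour lies in
      \<open>K1\<close>.\<close>
    show False
    proof (cases "P k1")
      case P: True
      have "r \<in> K1" using c1 k1 r(2) P b1(2) K_H1 unfolding constant_outside_def by blast
      then have "r + k1 \<notin> K1" using k1 add_mem_iff [OF sK1] by blast
      moreover have "r + k1 \<in> ?H1" using b1 k1 K_H1 s1 add_mem_iff' by blast
      ultimately have "P (r + k1)"
        using c1 k1 P K_H1 unfolding constant_outside_def by blast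
      moreover have "P (h + k1)" using PK h k1 KH add_mem_iff' sH sK by blast
      moreover have "\<not> P (r + h)" "\<not> P (r + h + k1)"
      proof -
        have e: "b + h + (r + h) = b + r" "b + h + (r + h + k1) = (b + r) + k1"
          by (simp_all add: char2_simps)
        have "b + r + k1 \<in> K" using r k1 add_mem_iff' sK by blast
        then show "\<not> P (r + h)" "\<not> P (r + h + k1)"
          using True r e addW hW k1W by metis+
      qed
      \<comment> \<open>The pairwise sums are \<open>h\<close>, \<open>h + k1\<close> and
        \<open>k1\<close>, the total is \<open>r + k1\<close>.\<close>
      ultimately show False
        using noclawD [OF nc(2), of r "r + h" "r + h + k1"] r Ph P addW hW k1W
        by (auto simp: char2_simps)
    next
      case P: False
      have "b \<in> K1" using c1 k1 b(3) P b1 K_H1 unfolding constant_outside_def by blast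
      then have "b + k1 \<notin> K1" using k1 add_mem_iff [OF sK1] by blast
      moreover have "b + k1 \<in> ?H1" using b1 k1 K_H1 s1 add_mem_iff' by blast
      ultimately have "\<not> P (b + k1)"
        using c1 k1 P K_H1 unfolding constant_outside_def by blast
      moreover have "P (h + k1)" using PK h k1 KH add_mem_iff' sH sK by blast
      moreover have "\<not> P (b + h)" "\<not> P (b + h + k1)"
      proof -
        have e: "b + h + (b + h) = 0" "b + h + (b + h + k1) = k1"
          by (simp_all add: char2_simps)
        then show "\<not> P (b + h)" "\<not> P (b + h + k1)"
          using True bh e addW k1 k1W zero by metis+
      qed
      \<comment> \<open>The pairwise sums are \<open>b + h\<close>, \<open>b + h + k1\<close> and
        \<open>k1\<close>, the total is \<open>b + k1\<close>.\<close>
      ultimately show False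
        using noclawD [OF nc(1), of b h "h + k1"] b Ph P addW hW k1W
        by (auto simp: char2_simps)
    qed
  next
    case False
    then obtain b2 where b2: "b2 \<in> W" "b + h + b2 \<in> K" "P b2" by blast
    have b22: "b2 \<in> ?H2" "r2 \<in> ?H2" using b2 r2 by (auto simp: adjoin_def)
    have b2H: "b2 \<notin> H" using b2 bh KH add_mem_iff' [OF sH] by blast
    have "?H2 \<noteq> {0}" using b22 b2H zero KH by (metis singletonD subsetD)
    then obtain K2 where K2: "hyperplane ?H2 K2" and c2: "constant_outside P ?H2 K2"
      using IH [OF s2 p2] by blast
    note sK2 = hyperplaneD(1) [OF K2]
    have "K2 \<noteq> K" using c2 b22 b2 b2H r2 KH unfolding constant_outside_def by blast
    then obtain k2 where k2: "k2 \<in> K" "k2 \<notin> K2"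
      using hyperplane_not_nested [OF h2 K2] s2 by blast
    \<comment> \<open>\<open>K\<close> is not the union of its proper subspaces cut out by
      \<open>K1\<close> and \<open>K2\<close>: if \<open>k1\<close> and \<open>k2\<close> each lie
      in one of them, \<open>k1 + k2\<close> avoids both.\<close>
    obtain k where k: "k \<in> K" "k \<notin> K1" "k \<notin> K2"
    proof (cases "k1 \<in> K2")
      case k1K2: True
      show ?thesis
      proof (cases "k2 \<in> K1")
        case True
        then have "k1 + k2 \<in> K" "k1 + k2 \<notin> K1" "k1 + k2 \<notin> K2"
          using k1 k2 k1K2 sK sK1 sK2 add_mem_iff add_mem_iff' by blast+
        then show ?thesis by (rule that)
      qed (use that k2 in blast)
    qed (use that k1 in blast)
    have same1: "P x = P k" if "x \<in> ?H1" "x \<notin> K1" for x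
      using c1 k K_H1 that unfolding constant_outside_def by blast
    have same2: "P x = P k" if "x \<in> ?H2" "x \<notin> K2" for x
      using c2 k K_H2 that unfolding constant_outside_def by blast
    have kH: "k \<in> H" "k \<in> W" using k KH HW by blast+
    show False
    proof (cases "P k")
      case P: False
      have "b \<in> K1" "b2 \<in> K2" using same1 [of b] same2 [of b2] b b1 b2 b22 P by blast+
      then have "\<not> P (b + k)" "\<not> P (b2 + k)"
        using same1 [of "b + k"] same2 [of "b2 + k"] P k b1 b22 s1 s2 sK1 sK2 K_H1 K_H2
          add_mem_iff add_mem_iff' by blast+
      moreover have "P (b + b2)" "P (b + b2 + k)"
      proof -
        have "b + b2 = h + (b + h + b2)" by (simp add: char2_simps)
        then have "b + b2 \<in> H" "b + b2 \<notin> K"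
          using h b2 KH add_mem_iff' sK sH by (metis subsetD)+
        then show "P (b + b2)" "P (b + b2 + k)" using PK k kH add_mem_iff' sK sH by blast+
      qed
      \<comment> \<open>The pairwise sums are \<open>b\<close>, \<open>b2\<close> and
        \<open>b + b2\<close>, the total is \<open>b + b2 + k\<close>.\<close>
      ultimately show False
        using noclawD [OF nc(2), of k "b + k" "b2 + k"] b b2 P kH addW by (auto simp: char2_simps)
    next
      case P: True
      have rK1: "x \<in> K1" if "x \<in> ?H1" "\<not> P x" for x using same1 that P by blast
      have rK2: "x \<in> K2" if "x \<in> ?H2" "\<not> P x" for x using same2 that P by blast
      \<comment> \<open>In the absence of claws, all vectors violating \<open>P\<close> lie in the span of \<open>r\<close>, \<open>r2\<close> and \<open>D0\<close>,
        which misses \<open>k\<close>.\<close>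
      define D0 where "D0 = K \<inter> (K1 \<inter> K2)"
      have sD0: "subspace D0" unfolding D0_def using sK sK1 sK2 by (simp add: subspace_iff)
      define D where "D = adjoin r (adjoin r2 D0)"
      have sD: "subspace D" unfolding D_def by (intro subspace_adjoin sD0)
      have D0W: "D0 \<subseteq> W" unfolding D0_def using KH HW by blast
      have DW: "D \<subseteq> W" unfolding D_def using r r2 by (intro adjoin_subset W D0W)
      \<comment> \<open>Among the cosets of \<open>D0\<close> in \<open>D\<close> only
        \<open>D0\<close> itself meets \<open>K\<close>, and it lies in \<open>K1\<close>, which
        misses \<open>k\<close>.\<close>
      have "k \<notin> D"
      proof
        have ri: "x + k \<notin> K" if "x \<notin> K" for x using add_mem_iff' sK k that by blast
        have "k \<notin> K1" "r + k \<notin> K" "r2 + k \<notin> K" "r + r2 + k \<notin> K"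
          using k ri r r2 rH KH by blast+
        moreover assume "k \<in> D"
        ultimately show False unfolding D_def adjoin_def D0_def by (auto simp: add_ac)
      qed
      then have "D \<subset> W" using DW kH by blast
      then obtain x where x: "x \<in> W" "x \<notin> D" "\<not> P x" using ex [OF sD] by blast
      have rK: "r \<in> K1" "r2 \<in> K2" using rK1 rK2 b1 b22 r r2 by blast+
      have Prr: "P (r + r2)" using PK rH by blast
      have Prrk: "P (r + r2 + y)" if "y \<in> K" for y
        using PK rH that KH add_mem_iff' sK sH by blast
      from cases [OF x(1)] consider "x \<in> K" | "x \<in> H" "x \<notin> K" | "b + x \<in> K" | "b + h + x \<in> K" by blast
      then show False
      proof cases
        case 1
        then have "x \<in> D0" unfolding D0_def using rK1 rK2 K_H1 K_H2 x by blast
        then show False using x subset_adjoin unfolding D_def by blast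
      next
        case 2
        then show False using PK x by blast
      next
        case 3
        \<comment> \<open>\<open>x\<close> is in the coset \<open>r + K\<close>, so \<open>y\<close>
          is in \<open>K\<close>. Both \<open>r\<close> and \<open>x\<close> lie in
          \<open>K1\<close>, hence so does \<open>y\<close>; if \<open>K2\<close> contained
          \<open>y\<close> too, \<open>x\<close> would fall into \<open>D\<close>.\<close>
        define y where "y = r + x"
        have y: "x = r + y" unfolding y_def by (simp add: char2_simps)
        have "y = (b + r) + (b + x)" unfolding y_def by (simp add: char2_simps)
        then have yK: "y \<in> K" using 3 r sK by (simp add: subspace_iff)
        have "x \<in> K1" using rK1 x 3 by (simp add: adjoin_def)
        then have yK1: "y \<in> K1" using rK sK1 add_mem_iff y_def by blast
        have "y \<notin> K2"
        proof
          assume "y \<in> K2"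
          then have "r + x \<in> D0" using yK yK1 by (simp add: D0_def y_def)
          then show False using x by (simp add: D_def adjoin_def)
        qed
        moreover from this have "r2 + y \<notin> K2" using rK sK2 add_mem_iff by blast
        moreover have "r2 + y \<in> ?H2" using b22 s2 yK K_H2 add_mem_iff by blast
        ultimately have "P y" "P (r2 + y)" using same2 P yK K_H2 by blast+
        \<comment> \<open>The pairwise sums are \<open>r + r2\<close>, \<open>y\<close> and
          \<open>r + r2 + y\<close>, the total is \<open>r2 + y\<close>.\<close>
        then show False
          using noclawD [OF nc(2), of r r2 x] r r2 x Prr Prrk [OF yK]
          by (auto simp: char2_simps y)
      next
        case 4
        define y where "y = r2 + x"
        have y: "x = r2 + y" unfolding y_def by (simp add: char2_simps)
        have "y = (b + h + r2) + (b + h + x)" unfolding y_def by (simp add: char2_simps)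
        then have yK: "y \<in> K" using 4 r2 sK by (simp add: subspace_iff)
        have "x \<in> K2" using rK2 x 4 by (simp add: adjoin_def)
        then have yK2: "y \<in> K2" using rK sK2 add_mem_iff y_def by blast
        have "y \<notin> K1"
        proof
          assume "y \<in> K1"
          then have "r2 + x \<in> D0" using yK yK2 by (simp add: D0_def y_def)
          then show False using x by (simp add: D_def adjoin_def)
        qed
        moreover from this have "r + y \<notin> K1" using rK sK1 add_mem_iff by blast
        moreover have "r + y \<in> ?H1" using b1 s1 yK K_H1 add_mem_iff by blast
        ultimately have "P y" "P (r + y)" using same1 P yK K_H1 by blast+
        then show False
          using noclawD [OF nc(2), of r r2 x] r r2 x Prr Prrk [OF yK]
          by (auto simp: char2_simps y)
      qed
    qed
  qed
qed

lemma exists_hyperplane_constant_outside: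
  assumes "finite W" "subspace W" "W \<noteq> {0}" "noclaw W P" "noclaw W (\<lambda>x. \<not> P x)"
  shows "\<exists>H. hyperplane W H \<and> constant_outside P W H"
  using assms
proof (induction "card W" arbitrary: W rule: less_induct)
  case less
  have IH: "\<exists>L. hyperplane U L \<and> constant_outside P U L"
    if "subspace U" "U \<subset> W" "U \<noteq> {0}" for U
  proof (rule less.hyps)
    show "card U < card W" "finite U"
      using that less.prems psubset_card_mono finite_subset by blast+
    show "noclaw U P" "noclaw U (\<lambda>x. \<not> P x)"
      using noclaw_subset less.prems that by blast+
  qed (use that in blast)+
  have "{0} \<subset> W" "subspace {0}" using less.prems by (auto simp: subspace_iff)
  then obtain H where H: "hyperplane W H"
    using proper_subspace_in_hyperplane less.prems by metis
  show ?case
  proof (cases "H = {0}")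
    case True
    \<comment> \<open>\<open>W\<close> is one-dimensional here, with a single nonzero vector, and
      \<open>{0}\<close> has no hyperplane to induct on.\<close>
    have "x = y" if "x \<in> W" "x \<noteq> 0" "y \<in> W" "y \<noteq> 0" for x y
    proof -
      have "x + y = 0" using hyperplaneD(3) [OF H] that True by blast
      then show ?thesis by (metis add_self_left add.right_neutral)
    qed
    then have "constant_outside P W H" using True unfolding constant_outside_def by blast
    then show ?thesis using H by blast
  next
    case False
    then obtain K where K: "hyperplane H K" "constant_outside P H K"
      using IH H hyperplaneD by blast
    then consider "\<And>x. x \<in> H \<Longrightarrow> x \<notin> K \<Longrightarrow> P x" | "\<And>x. x \<in> H \<Longrightarrow> x \<notin> K \<Longrightarrow> \<not> P x"
      unfolding constant_outside_def by blast
    then have "\<exists>D. subspace D \<and> D \<subset> W \<and> constant_outside P W D"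
    proof cases
      case 1
      then show ?thesis
        using constant_outside_step [of W P H K] less.prems H K IH by blast
    next
      case 2
      then show ?thesis
        using constant_outside_step [of W "\<lambda>x. \<not> P x" H K] less.prems H K IH
        unfolding constant_outside_Not by simp
    qed
    then show ?thesis using constant_outside_hyperplane less.prems by blast
  qed
qed

section \<open>Colourings built along a chain of subspaces\<close>

text \<open>Vectors of opposite colours cannot both lie outside \<open>D\<close>. If just one of
  \<open>a\<close> and \<open>b\<close> were in \<open>D\<close>, the other one and
  \<open>a + b\<close> would be such a pair; likewise for \<open>b\<close> and \<open>c\<close>. So
  a claw has its basis inside \<open>D\<close>, or outside it; in the latter case
  \<open>a + b\<close> is in \<open>D\<close>, and \<open>a\<close> and \<open>a + b + c\<close> are
  such a pair.\<close>

lemma noclaw_extend: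
  assumes "subspace W" "subspace D" "noclaw D P" "constant_outside P W D"
  shows "noclaw W P"
  unfolding noclaw_def
proof (intro ballI notI, elim conjE)
  fix a b c
  assume W: "a \<in> W" "b \<in> W" "c \<in> W" and P: "P a" "P b" "P c"
    and N: "\<not> P (a + b)" "\<not> P (a + c)" "\<not> P (b + c)" "\<not> P (a + b + c)"
  have sums: "a + b \<in> W" "a + c \<in> W" "b + c \<in> W" "a + b + c \<in> W"
    using W assms(1) by (auto simp: subspace_iff)
  have differ: "x \<in> D \<or> y \<in> D" if "P x" "\<not> P y" "x \<in> W" "y \<in> W" for x y
    using assms(4) that unfolding constant_outside_def by blast
  have ab: "a \<in> D \<longleftrightarrow> b \<in> D"
    using differ [of a "a + b"] differ [of b "a + b"] W P N sums assms(2)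
      add_mem_iff add_mem_iff' by blast
  have bc: "b \<in> D \<longleftrightarrow> c \<in> D"
    using differ [of b "b + c"] differ [of c "b + c"] W P N sums assms(2)
      add_mem_iff add_mem_iff' by blast
  show False
  proof (cases "a \<in> D")
    case True
    then show False using ab bc assms(3) P N unfolding noclaw_def by blast
  next
    case False
    then have "a + b \<in> D" using differ [of a "a + b"] W P N sums by blast
    then have "a + b + c \<notin> D" using False ab bc add_mem_iff assms(2) by blast
    then show False using differ [of a "a + b + c"] False W P N sums by blast
  qed
qed

lemma noclaw_0: "noclaw {0::'a} P"
  by (simp add: noclaw_def)

text \<open>Serves to pass from \<open>G - E\<close>, which omits \<open>0\<close>, to the full
  complement of \<open>E\<close>. If \<open>0\<close> were among the seven vectors of a claw, two
  vectors of opposite colours would coincide.\<close>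

lemma noclaw_nonzero_iff: "noclaw (W :: 'a set) (\<lambda>x. x \<noteq> 0 \<and> P x) \<longleftrightarrow> noclaw W P"
proof -
  have "(a \<noteq> 0 \<and> P a) \<and> (b \<noteq> 0 \<and> P b) \<and> (c \<noteq> 0 \<and> P c) \<and> \<not> (a + b \<noteq> 0 \<and> P (a + b)) \<and>
      \<not> (a + c \<noteq> 0 \<and> P (a + c)) \<and> \<not> (b + c \<noteq> 0 \<and> P (b + c)) \<and> \<not> (a + b + c \<noteq> 0 \<and> P (a + b + c))
    \<longleftrightarrow> P a \<and> P b \<and> P c \<and> \<not> P (a + b) \<and> \<not> P (a + c) \<and> \<not> P (b + c) \<and> \<not> P (a + b + c)" for a b c
  proof -
    have "c = a + b + (a + b + c)" "b = a + c + (a + b + c)" "a = b + c + (a + b + c)"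
      by (simp_all add: char2_simps)
    then show ?thesis by (metis add.left_neutral add.right_neutral)
  qed
  then show ?thesis unfolding noclaw_def by presburger
qed

text \<open>The last hypothesis allows \<open>P\<close> to be membership in \<open>E\<close> or its
  negation, so one induction along the chain, adding a layer at a time by
  \<open>noclaw_extend\<close>, serves both colours.\<close>

lemma target_imp_noclaw:
  assumes tg: "target s (E, G)" and G: "0 \<notin> G" "subspace (V G)" "E \<subseteq> G"
    and P: "\<And>W D. constant_outside (\<lambda>x. x \<in> E) W D \<Longrightarrow> constant_outside P W D"
  shows "noclaw (V G) P"
proof -
  obtain k :: nat and F where fl: "\<And>i. i \<le> k \<Longrightarrow> flat s G (F i)"
    and ch: "\<And>i. i < k \<Longrightarrow> F i \<subseteq> F (i + 1)"
    and E: "E = (\<Union>i\<in>{i. i < k \<and> even i}. F (i + 1) - F i)"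
    using tg unfolding target_def by auto
  have mono: "F i \<subseteq> F j" if "i \<le> j" "j \<le> k" for i j
    using that
  proof (induction j rule: dec_induct)
    case (step n)
    then show ?case using ch [of n] by fastforce
  qed simp
  have sub: "subspace (V (F i))" "F i \<subseteq> G" if "i \<le> k" for i
    using fl [OF that] by (auto simp: flat_def)
  \<comment> \<open>The chain increases, so its layers are disjoint and each vector has only one
    index to test.\<close>
  have layer: "x \<in> E \<longleftrightarrow> even i" if "x \<in> F (i + 1)" "x \<notin> F i" "i < k" for x i
  proof
    assume "x \<in> E"
    then obtain j where j: "j < k" "even j" "x \<in> F (j + 1)" "x \<notin> F j" using E by auto
    have "\<not> j < i" using mono [of "j + 1" i] j that by auto
    moreover have "\<not> i < j" using mono [of "i + 1" j] j that by auto
    ultimately show "even i" using j by (metis linorder_neqE_nat)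
  qed (use E that in auto)
  have "x \<notin> E" if "x \<in> F 0" for x
  proof
    assume "x \<in> E"
    then obtain j where "j < k" "x \<notin> F j" using E by auto
    then show False using mono [of 0 j] that by auto
  qed
  then have base: "constant_outside (\<lambda>x. x \<in> E) (V (F 0)) {0}"
    by (auto simp: constant_outside_def V_def)
  have s0: "subspace {0}" by (simp add: subspace_iff)
  have noclaw_F: "j \<le> k \<Longrightarrow> noclaw (V (F j)) P" for j
  proof (induction j)
    case 0
    show ?case using noclaw_extend [OF sub(1) s0 noclaw_0 P [OF base]] by simp
  next
    case (Suc j)
    have "constant_outside (\<lambda>x. x \<in> E) (V (F (Suc j))) (V (F j))"
      using layer [of _ j] Suc.prems by (auto simp: constant_outside_def V_def)
    then show ?case
      using noclaw_extend [OF sub(1) [of "Suc j"] sub(1) [of j] Suc.IH P] Suc.prems by simp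
  qed
  have "E \<subseteq> F k"
  proof
    fix x assume "x \<in> E"
    then obtain j where "j < k" "x \<in> F (j + 1)" using E by auto
    then show "x \<in> F k" using mono [of "j + 1" k] by auto
  qed
  \<comment> \<open>The chain may stop short of \<open>G\<close>; what lies beyond
    \<open>F k\<close> misses \<open>E\<close> and acts as a last layer, just as \<open>F 0\<close>
    acts as a first one over \<open>{0}\<close>.\<close>
  then have "constant_outside (\<lambda>x. x \<in> E) (V G) (V (F k))"
    using G by (auto simp: constant_outside_def V_def)
  then show ?thesis using noclaw_extend [OF G(2) sub(1) [of k] noclaw_F [of k] P] by simp
qed

text \<open>Evenness of \<open>k\<close> and the end of the chain at \<open>W - {0}\<close> are
  there for the induction: the layer outside a hyperplane is then added at an even index.\<close>

lemma flat_chain: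
  assumes "finite W" "subspace W" "0 \<notin> E" "noclaw W (\<lambda>x. x \<in> E)" "noclaw W (\<lambda>x. x \<notin> E)"
  shows "\<exists>(k::nat) F. even k \<and> F k = W - {0} \<and> (\<forall>i\<le>k. F i \<subseteq> W - {0} \<and> subspace (V (F i))) \<and>
    (\<forall>i<k. F i \<subseteq> F (i + 1)) \<and> E \<inter> W = (\<Union>i\<in>{i. i < k \<and> even i}. F (i + 1) - F i)"
  using assms
proof (induction "card W" arbitrary: W rule: less_induct)
  case less
  have V: "V (U - {0}) = U" if "subspace U" for U
    using that by (auto simp: V_def subspace_iff)
  show ?case
  proof (cases "W = {0}")
    case True
    show ?thesis
      by (rule exI [of _ 0], rule exI [of _ "\<lambda>_. {}"]) (use True less.prems in \<open>auto simp: V_def\<close>)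
  next
    case False
    then obtain H where H: "hyperplane W H" and c: "constant_outside (\<lambda>x. x \<in> E) W H"
      using exists_hyperplane_constant_outside [of W "\<lambda>x. x \<in> E"] less.prems by blast
    note sH = hyperplaneD(1) [OF H] and HW = hyperplaneD(2) [OF H]
    have fH: "card H < card W" "finite H"
      using HW less.prems psubset_card_mono finite_subset by blast+
    have ncH: "noclaw H (\<lambda>x. x \<in> E)" "noclaw H (\<lambda>x. x \<notin> E)"
      using noclaw_subset less.prems HW by blast+
    obtain k :: nat and F where k: "even k" "F k = H - {0}"
      and F: "\<forall>i\<le>k. F i \<subseteq> H - {0} \<and> subspace (V (F i))"
      and ch: "\<forall>i<k. F i \<subseteq> F (i + 1)"
      and E: "E \<inter> H = (\<Union>i\<in>{i. i < k \<and> even i}. F (i + 1) - F i)"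
      using less.hyps [OF fH sH less.prems(3) ncH] by (elim exE conjE) (rule that)
    \<comment> \<open>Two flats are appended, \<open>A\<close> and \<open>W - {0}\<close>, which
      keeps the length even. The layer below \<open>A\<close> belongs to \<open>E\<close>, the one
      above it does not. As \<open>W - H\<close> is monochromatic, it is one of these layers and the
      other is empty.\<close>
    define A where "A = (if E \<inter> (W - H) = {} then H - {0} else W - {0})"
    define F' where "F' i = (if i \<le> k then F i else if i = k + 1 then A else W - {0})" for i
    have 0: "0 \<in> H" "0 \<in> W" using sH less.prems by (auto simp: subspace_iff)
    have A: "H - {0} \<subseteq> A" "A \<subseteq> W - {0}" "subspace (V A)" "A - H = E \<inter> (W - H)"
      using HW V [OF sH] V [of W] sH less.prems c 0
      by (auto simp: A_def constant_outside_def)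
    have idx: "{i. i < k + 2 \<and> even i} = insert k {i. i < k \<and> even i}"
      using k(1) by (auto simp: less_Suc_eq)
    have "F' (k + 1) - F' k = E \<inter> (W - H)"
      using A k 0 less.prems by (auto simp: F'_def)
    moreover have "(\<Union>i\<in>{i. i < k \<and> even i}. F' (i + 1) - F' i) = E \<inter> H"
      unfolding E by (rule SUP_cong) (auto simp: F'_def)
    ultimately have "E \<inter> W = (\<Union>i\<in>{i. i < k + 2 \<and> even i}. F' (i + 1) - F' i)"
      unfolding idx using HW by auto
    moreover have "F' i \<subseteq> W - {0} \<and> subspace (V (F' i))" for i
      using F A HW V [of W] less.prems by (auto simp: F'_def)
    moreover have "F' i \<subseteq> F' (i + 1)" if "i < k + 2" for i
      using ch k A that HW by (auto simp: F'_def not_le less_Suc_eq_le)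
    moreover have "even (k + 2)" "F' (k + 2) = W - {0}"
      using k by (auto simp: F'_def)
    ultimately show ?thesis by (intro exI [of _ "k + 2"] exI [of _ F']) simp
  qed
qed

section \<open>Claws in matroids and in colourings\<close>

text \<open>There are only two scalars, so each generator at most doubles the span.\<close>

lemma finite_span:
  assumes "finite S"
  shows "finite (span S)"
  using assms
proof (induction S)
  case (insert a S)
  have "span (insert a S) \<subseteq> (\<Union>k. (\<lambda>x. x + s k a) ` span S)"
  proof
    fix x assume "x \<in> span (insert a S)"
    then obtain k where "x - s k a \<in> span S" by (auto simp: span_insert)
    then have "x \<in> (\<lambda>y. y + s k a) ` span S" by (intro image_eqI [of _ _ "x - s k a"]) auto
    then show "x \<in> (\<Union>k. (\<lambda>x. x + s k a) ` span S)" by blast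
  qed
  moreover have "finite (UNIV :: bit set)"
  proof (rule finite_subset)
    show "(UNIV :: bit set) \<subseteq> {0, 1}" by (auto intro: bit.exhaust)
  qed simp
  ultimately show ?case using insert.IH finite_subset by blast
qed simp

text \<open>A forbidden triple \<open>a\<close>, \<open>b\<close>, \<open>c\<close> spans a
  three-dimensional flat that meets \<open>E\<close> exactly in the triple; the coordinate map
  \<open>g\<close> identifies the standard claw with this restriction.\<close>

lemma claw_free_imp_noclaw:
  assumes M: "is_matroid s (E, G)" and cf: "claw_free s (E, G)"
  shows "noclaw (V G) (\<lambda>x. x \<in> E)"
  unfolding noclaw_def
proof (intro ballI notI, elim conjE)
  fix a b c
  assume W: "a \<in> V G" "b \<in> V G" "c \<in> V G" and P: "a \<in> E" "b \<in> E" "c \<in> E"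
    and N: "a + b \<notin> E" "a + c \<notin> E" "b + c \<notin> E" "a + b + c \<notin> E"
  have G: "0 \<notin> G" "subspace (V G)" "E \<subseteq> G" using M by (auto simp: is_matroid_def)
  have nz: "a \<noteq> 0" "b \<noteq> 0" "c \<noteq> 0" using P G by auto
  have nz2: "a + b \<noteq> 0" "a + c \<noteq> 0" "b + c \<noteq> 0" "a + b + c \<noteq> 0"
  proof -
    have "c = a + b + (a + b + c)" "b = a + c + (a + b + c)" "a = b + c + (a + b + c)"
      by (simp_all add: char2_simps)
    then show "a + b \<noteq> 0" "a + c \<noteq> 0" "b + c \<noteq> 0" "a + b + c \<noteq> 0"
      using P N by (metis add.left_neutral add.right_neutral)+
  qed
  define g where "g v = s (v $ 1) a + s (v $ 2) b + s (v $ 3) c" for v :: "bit ^ 3"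
  have g_add: "g (u + v) = g u + g v" for u v
    unfolding g_def vector_add_component scale_left_distrib by (simp only: add_ac)
  have g_scale: "g (k *s v) = s k (g v)" for k v
    by (simp add: g_def scale_right_distrib)
  have g0: "g 0 = 0" by (simp add: g_def)
  \<comment> \<open>The eight values of \<open>g\<close>, from which both its injectivity and
    \<open>E \<inter> F\<close> are read off.\<close>
  have g_cases: "(v = 0 \<and> g v = 0) \<or> (v = axis 1 1 \<and> g v = a) \<or> (v = axis 2 1 \<and> g v = b) \<or>
      (v = axis 3 1 \<and> g v = c) \<or> g v \<in> {a + b, a + c, b + c, a + b + c}" for v
    by (cases "v $ 1"; cases "v $ 2"; cases "v $ 3")
      (simp_all add: g_def vec_eq_iff forall_3 axis_def)
  have g_ker: "v = 0" if "g v = 0" for v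
    using g_cases [of v] nz nz2 that by auto
  have "inj g"
  proof (rule injI)
    fix u v assume "g u = g v"
    then have "g (u + v) = 0" by (simp add: g_add add_self)
    then have uv: "u + v = 0" by (rule g_ker)
    have "u $ i = v $ i" for i
      using uv by (cases "u $ i"; cases "v $ i") (auto simp: vec_eq_iff dest: spec [of _ i])
    then show "u = v" by (simp add: vec_eq_iff)
  qed
  have g_axis: "g (axis 1 1) = a" "g (axis 2 1) = b" "g (axis 3 1) = c"
    by (simp_all add: g_def axis_def)
  have cb: "cart_basis = {axis 1 1, axis 2 1, axis 3 1 :: bit ^ 3}"
    unfolding cart_basis_def Setcompr_eq_image UNIV_3 by simp
  define F where "F = range g - {0}"
  have VF: "V F = range g" using g0 by (auto simp: F_def V_def)
  have rG: "range g \<subseteq> V G"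
    unfolding g_def using G(2) W by (auto intro!: subspace_add subspace_scale)
  have "subspace (range g)"
    unfolding subspace_iff using g0 g_add by (metis (no_types, lifting) rangeE rangeI)
  moreover have "F \<subseteq> G" using rG by (auto simp: F_def V_def)
  ultimately have flF: "flat s G F" by (simp add: flat_def VF)
  have inv: "inv g (g v) = v" for v using \<open>inj g\<close> by simp
  have VU: "V (UNIV - {0}) = (UNIV :: (bit ^ 3) set)" by (auto simp: V_def)
  have EF: "E \<inter> F = {a, b, c}"
  proof -
    have "x \<in> {a, b, c}" if "x \<in> E" "x = g v" for x v
      using g_cases [of v] that N G by auto
    then have "E \<inter> F \<subseteq> {a, b, c}" unfolding F_def by blast
    moreover have "a \<in> range g" "b \<in> range g" "c \<in> range g" using g_axis by (metis rangeI)+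
    ultimately show ?thesis using P nz unfolding F_def by blast
  qed
  \<comment> \<open>An isomorphism must start from the restriction, hence the inverse of
    \<open>g\<close>.\<close>
  have "bij_betw (inv g) (V F) (V (UNIV - {0}))"
    unfolding VU VF using \<open>inj g\<close> by (simp add: inj_imp_bij_betw_inv)
  moreover have "\<forall>x\<in>V F. \<forall>y\<in>V F. inv g (x + y) = inv g x + inv g y"
    unfolding VF by (auto simp: inv simp flip: g_add)
  moreover have "\<forall>k. \<forall>x\<in>V F. inv g (s k x) = k *s inv g x"
    unfolding VF by (auto simp: inv simp flip: g_scale)
  moreover have "inv g ` (E \<inter> F) = cart_basis"
    unfolding EF cb using inv by (simp flip: g_axis)
  ultimately have "isomorphic s (*s) (E \<inter> F, F) (cart_basis, UNIV - {0 :: bit ^ 3})"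
    unfolding isomorphic_def prod.case by blast
  moreover have "is_claw (*s) (cart_basis, UNIV - {0 :: bit ^ 3})"
  proof -
    have "(0 :: bit ^ 3) \<notin> cart_basis"
      using independent_cart_basis vec.dependent_zero by blast
    moreover have "vec.dim (UNIV :: (bit ^ 3) set) = 3"
      by (simp add: vec.dim_UNIV vec.dimension_def card_cart_basis)
    ultimately show ?thesis
      unfolding is_claw_def is_matroid_def prod.case VU
      by (intro conjI exI [of _ cart_basis] finite_cart_basis span_cart_basis
          independent_cart_basis vec.subspace_UNIV) auto
  qed
  ultimately show False
    using cf flF unfolding claw_free_def matroid_free_def induced_restriction_def by auto
qed

text \<open>The preimages in \<open>E\<close> of the basis of a claw form a forbidden triple,
  because sums of two or three distinct basis vectors never belong to the basis.\<close>

lemma noclaw_imp_claw_free: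
  assumes M: "is_matroid s (E, G)" and nc: "noclaw (V G) (\<lambda>x. x \<in> E)"
  shows "claw_free s (E, G)"
  unfolding claw_free_def matroid_free_def induced_restriction_def fst_conv snd_conv
proof (intro allI impI notI, elim exE conjE)
  fix N :: "(bit ^ 3) matroid" and F
  assume claw: "is_claw (*s) N" and fl: "flat s G F" and iso: "isomorphic s (*s) (E \<inter> F, F) N"
  obtain B G' where N: "N = (B, G')" by (cases N)
  have G: "0 \<notin> G" "E \<subseteq> G" using M by (auto simp: is_matroid_def)
  have F: "F \<subseteq> G" "subspace (V F)" using fl by (auto simp: flat_def)
  have ind: "vec.independent B" and "vec.dim (V G') = 3" "vec.span B = V G'"
    using claw N by (auto simp: is_claw_def)
  then have "card B = 3" by (metis vec.dim_span vec.dim_eq_card_independent)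
  then obtain p q r where B: "B = {p, q, r}" "p \<noteq> q" "p \<noteq> r" "q \<noteq> r" by (auto simp: card_3_iff)
  obtain f where f: "\<And>x y. x \<in> V F \<Longrightarrow> y \<in> V F \<Longrightarrow> f (x + y) = f x + f y" "f ` (E \<inter> F) = B"
    using iso N unfolding isomorphic_def by auto
  obtain a b c where abc: "a \<in> E \<inter> F" "f a = p" "b \<in> E \<inter> F" "f b = q" "c \<in> E \<inter> F" "f c = r"
  proof -
    have "p \<in> f ` (E \<inter> F)" "q \<in> f ` (E \<inter> F)" "r \<in> f ` (E \<inter> F)" using f(2) B by simp_all
    then show ?thesis using that by (elim imageE) simp
  qed
  have V: "a \<in> V F" "b \<in> V F" "c \<in> V F" using abc by (auto simp: V_def)
  have sums: "a + b \<in> V F" "a + c \<in> V F" "b + c \<in> V F" "a + b + c \<in> V F"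
    using V F(2) by (auto simp: subspace_iff)
  have E: "x \<notin> E" if "x \<in> V F" "f x \<notin> B" for x
  proof
    assume "x \<in> E"
    then have "x \<in> E \<inter> F" using that(1) G by (auto simp: V_def)
    then show False using f(2) that(2) by blast
  qed
  have nspan: "x \<notin> vec.span (B - {x})" if "x \<in> B" for x
    using ind that vec.dependent_def by blast
  have nz: "x \<noteq> 0" if "x \<in> B" for x using ind that vec.dependent_zero by blast
  \<comment> \<open>\<open>u + v = w\<close> contradicts independence; any other coincidence makes a
    basis vector or a sum of two of them vanish.\<close>
  have "u + v \<notin> B" "u + v + w \<notin> B" if uvw: "B = {u, v, w}" "u \<noteq> v" "u \<noteq> w" "v \<noteq> w" for u v w
  proof -
    have d: "B - {w} = {u, v}" using uvw by auto
    have "u + v \<in> vec.span {u, v}" by (intro vec.span_add vec.span_base) auto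
    then have "u + v \<noteq> w" using nspan [of w] uvw(1) d by force
    then show "u + v \<notin> B" using nz uvw by auto
    have nsum: "x + y \<noteq> 0" if "{x, y} \<subseteq> B" "x \<noteq> y" for x y
    proof
      assume "x + y = 0"
      then have "x = - y" by (simp add: eq_neg_iff_add_eq_0)
      moreover have "y \<in> B - {x}" using that by auto
      ultimately have "x \<in> vec.span (B - {x})" by (metis vec.span_base vec.span_neg)
      then show False using nspan [of x] that by auto
    qed
    have "u + v \<noteq> 0" "u + w \<noteq> 0" "v + w \<noteq> 0" by (intro nsum; use uvw in auto)+
    then show "u + v + w \<notin> B" using uvw by (auto simp: add_ac)
  qed
  note this [of p q r] this [of p r q] this [of q r p]
  then have "p + q \<notin> B" "p + r \<notin> B" "q + r \<notin> B" "p + q + r \<notin> B" using B by auto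
  then have "a + b \<notin> E" "a + c \<notin> E" "b + c \<notin> E" "a + b + c \<notin> E"
    using E sums f(1) V abc by (metis)+
  moreover have "V F \<subseteq> V G" using F by (auto simp: V_def)
  ultimately show False using nc V abc unfolding noclaw_def by blast
qed

lemma claw_free_iff_noclaw:
  "is_matroid s (E, G) \<Longrightarrow> claw_free s (E, G) \<longleftrightarrow> noclaw (V G) (\<lambda>x. x \<in> E)"
  using claw_free_imp_noclaw noclaw_imp_claw_free by (intro iffI) auto

end

section \<open>Anticlaws by complementation\<close>

text \<open>A linear bijection fixes \<open>0\<close>, so it carries \<open>F\<close> onto
  \<open>G\<close>, and by injectivity it respects set differences.\<close>

lemma isomorphic_complement:
  assumes "isomorphic s t (A, F) (B, G)" "0 \<notin> F" "0 \<notin> G" "A \<subseteq> F"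
  shows "isomorphic s t (F - A, F) (G - B, G)"
proof -
  obtain f where f: "bij_betw f (V F) (V G)"
    "\<forall>x\<in>V F. \<forall>y\<in>V F. f (x + y) = f x + f y"
    "\<forall>c. \<forall>x\<in>V F. f (s c x) = t c (f x)" "f ` A = B"
    using assms(1) unfolding isomorphic_def by auto
  have V: "0 \<in> V F" "V F - {0} = F" "V G - {0} = G" using assms by (auto simp: V_def)
  have "f (0 + 0) = f 0 + f 0" using f(2) V(1) by blast
  then have f0: "f 0 = 0" by simp
  have inj: "inj_on f (V F)" and im: "f ` V F = V G" using f(1) by (auto simp: bij_betw_def)
  have "f ` (V F - {0}) = V G - {0}"
    using inj_on_image_set_diff [OF inj, of "V F" "{0}"] V(1) im f0 by auto
  then have "f ` F = G" using V by simp
  moreover have "f ` (F - A) = f ` F - f ` A"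
    using inj_on_image_set_diff [OF inj, of F A] assms(4) by (auto simp: V_def)
  ultimately have "f ` (F - A) = G - B" using f(4) by simp
  then show ?thesis using f unfolding isomorphic_def by auto
qed

text \<open>Restriction to a flat commutes with complementation, so anticlaws induced by
  \<open>E\<close> are claws induced by \<open>G - E\<close>.\<close>

lemma anticlaw_free_iff:
  assumes "0 \<notin> G"
  shows "anticlaw_free s (E, G) \<longleftrightarrow> claw_free s (G - E, G)"
proof -
  have "matroid_free s (*s) (G' - B, G') (E, G) \<longleftrightarrow> matroid_free s (*s) (B, G') (G - E, G)"
    if "is_claw (*s) (B, G')" for B G' :: "(bit ^ 3) set"
  proof -
    have B: "0 \<notin> G'" "B \<subseteq> G'" using that by (auto simp: is_claw_def is_matroid_def)
    have "isomorphic s (*s) (E \<inter> F, F) (G' - B, G') \<longleftrightarrow>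
        isomorphic s (*s) ((G - E) \<inter> F, F) (B, G')" if "flat s G F" for F
    proof -
      have F: "F \<subseteq> G" "0 \<notin> F" using that assms by (auto simp: flat_def)
      have e: "(G - E) \<inter> F = F - (E \<inter> F)" "F - (F - (E \<inter> F)) = E \<inter> F" "G' - (G' - B) = B"
        using F B by auto
      show ?thesis
        using isomorphic_complement [of s "(*s)" "E \<inter> F" F "G' - B" G']
          isomorphic_complement [of s "(*s)" "F - (E \<inter> F)" F B G'] F B
        unfolding e by auto
    qed
    then show ?thesis unfolding matroid_free_def induced_restriction_def by auto
  qed
  then have "(\<forall>B G' :: (bit ^ 3) set. is_claw (*s) (B, G') \<longrightarrow> matroid_free s (*s) (G' - B, G') (E, G)) \<longleftrightarrow>
      (\<forall>B G' :: (bit ^ 3) set. is_claw (*s) (B, G') \<longrightarrow> matroid_free s (*s) (B, G') (G - E, G))"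
    by blast
  then show ?thesis
    unfolding anticlaw_free_def claw_free_def is_anticlaw_def matroid_complement_def
    by (auto simp: split_paired_all)
qed

theorem theorem1p11:
  fixes s :: "bit \<Rightarrow> 'a::ab_group_add \<Rightarrow> 'a" and M :: "'a set \<times> 'a set"
  assumes "vector_space s" and "is_matroid s M"
  shows "claw_free s M \<and> anticlaw_free s M \<longleftrightarrow> target s M"
proof -
  interpret binary_space s unfolding binary_space_def by (rule assms(1))
  obtain E G where M: "M = (E, G)" by (cases M)
  have G: "0 \<notin> G" "subspace (V G)" "E \<subseteq> G" and "\<exists>S. finite S \<and> span S = V G"
    using assms(2) M by (auto simp: is_matroid_def)
  then have fin: "finite (V G)" using finite_span by metis
  have mat: "is_matroid s (E, G)" "is_matroid s (G - E, G)"
    using assms(2) M by (auto simp: is_matroid_def)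
  have "claw_free s M \<and> anticlaw_free s M \<longleftrightarrow>
      noclaw (V G) (\<lambda>x. x \<in> E) \<and> noclaw (V G) (\<lambda>x. x \<in> G - E)"
    unfolding M anticlaw_free_iff [OF G(1)] using mat claw_free_iff_noclaw by metis
  \<comment> \<open>\<open>V G\<close> also contains \<open>0\<close>, which lies neither in
    \<open>E\<close> nor in \<open>G - E\<close>.\<close>
  also have "noclaw (V G) (\<lambda>x. x \<in> G - E) \<longleftrightarrow> noclaw (V G) (\<lambda>x. x \<noteq> 0 \<and> x \<notin> E)"
  proof -
    have e: "x \<in> G - E \<longleftrightarrow> x \<noteq> 0 \<and> x \<notin> E" if "x \<in> V G" for x
      using that G(1) by (auto simp: V_def)
    have sum: "x + y \<in> V G" if "x \<in> V G" "y \<in> V G" for x y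
      using that G(2) by (simp add: subspace_iff)
    show ?thesis unfolding noclaw_def by (intro ball_cong refl) (simp only: e sum)
  qed
  also have "\<dots> \<longleftrightarrow> noclaw (V G) (\<lambda>x. x \<notin> E)" by (rule noclaw_nonzero_iff)
  also have "noclaw (V G) (\<lambda>x. x \<in> E) \<and> noclaw (V G) (\<lambda>x. x \<notin> E) \<longleftrightarrow> target s M"
  proof
    assume nc: "noclaw (V G) (\<lambda>x. x \<in> E) \<and> noclaw (V G) (\<lambda>x. x \<notin> E)"
    have e: "V G - {0} = G" "E \<inter> V G = E" "0 \<notin> E" using G(1,3) by (auto simp: V_def)
    show "target s M"
      using flat_chain [OF fin G(2) e(3)] nc
      unfolding M target_def flat_def prod.case e by blast
  next
    assume "target s M"
    then have tg: "target s (E, G)" unfolding M .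
    \<comment> \<open>\<open>constant_outside_Not\<close> supplies what
      \<open>target_imp_noclaw\<close> demands of the negated colouring.\<close>
    show "noclaw (V G) (\<lambda>x. x \<in> E) \<and> noclaw (V G) (\<lambda>x. x \<notin> E)"
      using target_imp_noclaw [OF tg G(1-3)] constant_outside_Not [of "\<lambda>x. x \<in> E"] by blast
  qed
  finally show ?thesis .
qed

end
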